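(* For every integer $N\ge1$ and every integer $n\ge0$, the following identity holds (as rational functions in $x$): $$\sum_{l=0}^{n}(-1)^{n-l}\binom{N+n-l}{n-l}W_{l}^{(N+1)}(x)=\frac{1}{2^{N}N!}\sum_{i=1}^{N}\sum_{l=0}^{i}(-1)^{i-l}a_{i}(N)\frac{i!}{l!}\sum_{m+s+p=n}(-1)^{s}\binom{2N+m-i-1}{m}\binom{i-l+s}{s}(p+l)_{l}\,x^{i-2N-m}\,W_{p+l}(x),$$ where the innermost sum is over all integers $m,s,p\ge0$ with $m+s+p=n$.
   Context: The Chebyshev polynomials of the fourth kind $W_n(x)$ and the higher-order ones $W_n^{(\alpha)}(x)$ are defined by the formal power series in $t$ $$\frac{1+t}{1-2xt+t^{2}}=\sum_{n=0}^{\infty}W_{n}(x)t^{n},\qquad \left(\frac{1+t}{1-2xt+t^{2}}\right)^{\alpha}=\sum_{n=0}^{\infty}W_{n}^{(\alpha)}(x)t^{n}.$$ For a number $y$ and integer $n\ge1$, $(y)_{n}=y(y-1)\cdots(y-n+1)$ is the falling factorial, and $(y)_{0}=1$. The double factorial is $(2k-1)!!=(2k-1)(2k-3)\cdots 3\cdot 1$ for $k\ge1$, with $(-1)!!=1$. The numbers $a_i(N)$, $1\le i\le N$, are defined by $a_{1}(N)=(2N-3)!!$ and, for $2\le i\le N$, $$a_{i}(N)=\sum_{k_{i-1}=0}^{N-i}\ \sum_{k_{i-2}=0}^{N-i-k_{i-1}}\cdots\sum_{k_{1}=0}^{N-i-k_{i-1}-\cdots-k_{2}}2^{\sum_{j=1}^{i-1}k_{j}}\left[\prod_{j=2}^{i}\left(N-\sum_{l=j}^{i-1}k_{l}-\frac{2i+2-j}{2}\right)_{k_{j-1}}\right]\left(2\left(N-i-\sum_{j=1}^{i-1}k_{j}\right)-1\right)!!,$$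 where empty sums are $0$. *)

theory Defs
  imports "HOL-Computational_Algebra.Computational_Algebra" "HOL-Library.FuncSet"
begin

definition cheb4_gf :: "'a::field \<Rightarrow> 'a fps" where
  "cheb4_gf x = (1 + fps_X) / (1 - fps_const (2 * x) * fps_X + fps_X ^ 2)"

definition cheb4 :: "nat \<Rightarrow> 'a::field \<Rightarrow> 'a" where
  "cheb4 n x = fps_nth (cheb4_gf x) n"

(* Only natural orders are needed, so the power is the ordinary power of a power series. *)
definition cheb4_order :: "nat \<Rightarrow> nat \<Rightarrow> 'a::field \<Rightarrow> 'a" where
  "cheb4_order r n x = fps_nth (cheb4_gf x ^ r) n"

definition falling_fact :: "'a::comm_ring_1 \<Rightarrow> nat \<Rightarrow> 'a" where
  "falling_fact y n = (\<Prod>i<n. y - of_nat i)"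

(* (2k - 1)!!, indexed by k so that the value 1 at k = 0 is the empty product. *)
definition odd_dfact :: "nat \<Rightarrow> nat" where
  "odd_dfact k = (\<Prod>j=1..k. 2 * j - 1)"

(* The index tuples (k_1, ..., k_(i-1)) of the iterated sum with outermost variable k_(i-1):
   each k_j runs from 0 to N - i - k_(i-1) - ... - k_(j+1). The bound is written additively
   to avoid truncated subtraction. *)
definition coeff_indices :: "nat \<Rightarrow> nat \<Rightarrow> (nat \<Rightarrow> nat) set" where
  "coeff_indices i N =
     {k \<in> {1..<i} \<rightarrow>\<^sub>E {0..N - i}. \<forall>j\<in>{1..<i}. k j + (\<Sum>l\<in>{j<..<i}. k l) \<le> N - i}"

(* a_i(N) for 1 \<le> i \<le> N, as an element of an arbitrary field; here (2N - 3)!! is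
   odd_dfact (N - 1). *)
definition cheb_coeff :: "nat \<Rightarrow> nat \<Rightarrow> 'a::field" where
  "cheb_coeff i N =
     (if i = 1 then of_nat (odd_dfact (N - 1))
      else \<Sum>k\<in>coeff_indices i N.
        2 ^ (\<Sum>j\<in>{1..<i}. k j)
        * (\<Prod>j\<in>{2..i}.
             falling_fact
               (of_nat N - of_nat (\<Sum>l\<in>{j..<i}. k l) - (2 * of_nat i + 2 - of_nat j) / 2)
               (k (j - 1)))
        * of_nat (odd_dfact (N - i - (\<Sum>j\<in>{1..<i}. k j))))"

(* The indeterminate of the field of rational functions in one variable over 'a. *)
definition ratfun_X :: "'a::field poly fract" where
  "ratfun_X = to_fract [:0, 1:]"

end

theory Submission
  imports Defs
begin

text \<open>
  Put \<open>F = 1 / (1 - 2 x t + t\<^sup>2)\<close>. Since \<open>F' = 2 (x - t) F\<^sup>2\<close>, repeated differentiation gives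
  \<open>2\<^sup>N N! F\<^bsup>N+1\<^esup> = (\<Sum>i=1..N. a\<^sub>i(N) (x - t)\<^bsup>i-2N\<^esup> F\<^bsup>(i)\<^esup>)\<close>, where the coefficients satisfy
  \<open>a\<^sub>i\<^sub>+\<^sub>1(N+1) = (2N - i - 1) a\<^sub>i\<^sub>+\<^sub>1(N) + a\<^sub>i(N)\<close>; the iterated sums solve this recurrence.
  With \<open>F = W / (1 + t)\<close>, the left-hand side of the theorem is the \<open>n\<close>-th coefficient of
  \<open>F\<^bsup>N+1\<^esup> = W\<^bsup>N+1\<^esup> (1 + t)\<^bsup>-N-1\<^esup>\<close>, and the right-hand side is what Leibniz' rule for
  \<open>F\<^bsup>(i)\<^esup>\<close> and the binomial series yield for the \<open>n\<close>-th coefficient of the sum.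
\<close>

text \<open>The identity is proved over fields of characteristic 0 and then applied in the field of
  rational functions. The naturals embed there because \<open>to_fract\<close> is injective.\<close>

instance fract :: ("{idom, ring_char_0}") field_char_0
proof
  have "(of_nat n :: 'a fract) = to_fract (of_nat n)" for n
    by (induction n) simp_all
  then show "inj (of_nat :: nat \<Rightarrow> 'a fract)"
    by (simp add: inj_on_def)
qed

section \<open>Formal power series\<close>

lemma fps_nth_deriv_mult:
  fixes f g :: "'a::comm_ring_1 fps"
  shows "fps_nth_deriv n (f * g) =
    (\<Sum>l=0..n. of_nat (n choose l) * fps_nth_deriv l f * fps_nth_deriv (n - l) g)"
proof (induction n)
  case 0
  show ?case by simp
next
  case (Suc n)
  let ?d = "\<lambda>l k. fps_nth_deriv l f * fps_nth_deriv k g"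
  have "fps_nth_deriv (Suc n) (f * g) =
      (\<Sum>l=0..n. of_nat (n choose l) * ?d (Suc l) (n - l))
      + (\<Sum>l=0..n. of_nat (n choose l) * ?d l (Suc n - l))"
    unfolding fps_nth_deriv_commute Suc.IH fps_deriv_sum sum.distrib[symmetric]
    by (intro sum.cong refl)
       (simp add: fps_nth_deriv_commute[symmetric] Suc_diff_le algebra_simps
         del: fps_nth_deriv.simps)
  \<comment> \<open>The added summand \<open>l = Suc n\<close> is zero. Splitting off
    \<open>l = 0\<close> then puts both sums over the same terms \<open>?d (Suc l) (n - l)\<close>,
    where Pascal's rule merges them.\<close>
  also have "(\<Sum>l=0..n. of_nat (n choose l) * ?d l (Suc n - l))
      = (\<Sum>l=0..Suc n. of_nat (n choose l) * ?d l (Suc n - l))"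
    by (simp add: binomial_eq_0 del: fps_nth_deriv.simps(2))
  also have "\<dots> = ?d 0 (Suc n)
      + (\<Sum>l=0..n. of_nat (n choose Suc l) * ?d (Suc l) (n - l))"
    by (subst sum.atLeast0_atMost_Suc_shift) (simp del: fps_nth_deriv.simps(2))
  also have "(\<Sum>l=0..n. of_nat (n choose l) * ?d (Suc l) (n - l)) + \<dots>
      = ?d 0 (Suc n) + (\<Sum>l=0..n. of_nat (Suc n choose Suc l) * ?d (Suc l) (n - l))"
    by (simp add: sum.distrib algebra_simps del: fps_nth_deriv.simps(2))
  also have "\<dots> = (\<Sum>l=0..Suc n. of_nat (Suc n choose l) * ?d l (Suc n - l))"
    by (subst sum.atLeast0_atMost_Suc_shift[where n = n])
       (simp del: fps_nth_deriv.simps(2) binomial_Suc_Suc)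
  finally show ?case
    by (simp add: mult.assoc del: fps_nth_deriv.simps(2))
qed

lemma falling_fact_Suc_shift: "falling_fact (y + 1) (Suc n) = (y + 1) * falling_fact y n"
  unfolding falling_fact_def by (subst prod.lessThan_Suc_shift) (simp add: algebra_simps)

text \<open>Each differentiation multiplies by one more index; this is the source of the factor
  \<open>(p + l)_l\<close> in the theorem.\<close>

lemma fps_nth_deriv_nth:
  fixes f :: "'a::comm_ring_1 fps"
  shows "fps_nth (fps_nth_deriv l f) p = falling_fact (of_nat (p + l)) l * fps_nth f (p + l)"
proof (induction l arbitrary: f p)
  case 0
  show ?case by (simp add: falling_fact_def)
next
  case (Suc l)
  have "fps_nth (fps_nth_deriv (Suc l) f) p =
      (of_nat (p + l) + 1) * falling_fact (of_nat (p + l)) l * fps_nth f (Suc (p + l))"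
    by (simp add: Suc.IH algebra_simps)
  also have "(of_nat (p + l) + 1 :: 'a) * falling_fact (of_nat (p + l)) l =
      falling_fact (of_nat (p + Suc l)) (Suc l)"
    by (metis falling_fact_Suc_shift add_Suc_right of_nat_Suc add.commute)
  finally show ?case by simp
qed

text \<open>The Cauchy product taken twice, with \<open>k = m + s\<close> as intermediate degree; it
  produces the innermost sum of the theorem.\<close>

lemma fps_mult_nth_triple:
  fixes f g h :: "'a::semiring_0 fps"
  shows "fps_nth (f * g * h) n =
    (\<Sum>(m, s, p)\<in>{(m, s, p). m + s + p = n}. fps_nth f m * fps_nth g s * fps_nth h p)"
proof -
  have "fps_nth (f * g * h) n =
      (\<Sum>k=0..n. \<Sum>m=0..k. fps_nth f m * fps_nth g (k - m) * fps_nth h (n - k))"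
    by (simp add: fps_mult_nth sum_distrib_right)
  also have "\<dots> = (\<Sum>(k, m)\<in>(SIGMA k:{0..n}. {0..k}).
      fps_nth f m * fps_nth g (k - m) * fps_nth h (n - k))"
    by (subst sum.Sigma) auto
  also have "\<dots> =
      (\<Sum>(m, s, p)\<in>{(m, s, p). m + s + p = n}. fps_nth f m * fps_nth g s * fps_nth h p)"
    by (rule sum.reindex_bij_witness[of _ "\<lambda>(m, s, p). (m + s, m)" "\<lambda>(k, m). (m, k - m, n - k)"])
       auto
  finally show ?thesis .
qed

lemma one_plus_X_neg_power_nth:
  "fps_nth (inverse (1 + fps_X :: 'a::field_char_0 fps) ^ Suc k) s =
    (-1) ^ s * of_nat ((k + s) choose s)"
  using one_minus_const_fps_X_neg_power'[of "Suc k" "-1 :: 'a"]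
  by (simp add: fps_inverse_power mult.commute del: power_Suc flip: fps_const_neg)

text \<open>Factoring out \<open>x\<close> leaves \<open>1 - t / x\<close>, whose negative powers
  are binomial series.\<close>

lemma const_minus_X_neg_power_nth:
  fixes x :: "'a::field_char_0"
  assumes "x \<noteq> 0" "k > 0"
  shows "fps_nth (inverse (fps_const x - fps_X) ^ k) m =
    of_nat ((k + m - 1) choose m) * inverse x ^ (k + m)"
proof -
  have "fps_const x - fps_X = fps_const x * (1 - fps_const (inverse x) * fps_X)"
    using assms by (simp add: algebra_simps flip: mult.assoc)
  then have "inverse (fps_const x - fps_X) ^ k =
      fps_const (inverse x ^ k) * inverse ((1 - fps_const (inverse x) * fps_X) ^ k)"
    by (simp only: fps_inverse_mult power_mult_distrib fps_inverse_power fps_const_inverse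
        fps_const_power)
  then show ?thesis
    using assms by (simp add: one_minus_const_fps_X_neg_power' power_add)
qed

lemma fps_nth_deriv_inverse_one_plus_X:
  "fps_nth_deriv k (inverse (1 + fps_X :: 'a::field fps)) =
    (-1) ^ k * of_nat (fact k) * inverse (1 + fps_X) ^ Suc k"
proof (induction k)
  case 0
  show ?case by simp
next
  case (Suc k)
  define G where "G = inverse (1 + fps_X :: 'a fps)"
  have dG: "fps_deriv G = - (G ^ 2)"
    unfolding G_def by (simp add: fps_inverse_deriv power2_eq_square)
  have "fps_nth_deriv (Suc k) G = fps_deriv ((-1) ^ k * of_nat (fact k) * G ^ Suc k)"
    unfolding fps_nth_deriv_commute Suc.IH G_def ..
  also have "\<dots> = (-1) ^ k * of_nat (fact k) * fps_deriv (G ^ Suc k)"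
    \<comment> \<open>By parity the series \<open>(-1) ^ k\<close> is 1 or -1, so it passes through
      the derivative.\<close>
    by (cases "even k") (simp_all del: power_Suc)
  also have "fps_deriv (G ^ Suc k) = - of_nat (Suc k) * G ^ Suc (Suc k)"
    unfolding fps_deriv_power dG fps_of_nat by (simp add: power2_eq_square algebra_simps)
  also have "(-1) ^ k * of_nat (fact k) * \<dots> = (-1) ^ Suc k * of_nat (fact (Suc k)) * G ^ Suc (Suc k)"
    by (simp add: algebra_simps)
  finally show ?case unfolding G_def .
qed

section \<open>The coefficients\<close>

lemma finite_coeff_indices: "finite (coeff_indices i N)"
  unfolding coeff_indices_def
  by (rule finite_subset[of _ "{1..<i} \<rightarrow>\<^sub>E {0..N - i}"]) (auto intro: finite_PiE)

definition coeff_summand :: "nat \<Rightarrow> nat \<Rightarrow> (nat \<Rightarrow> nat) \<Rightarrow> 'a::field" where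
  "coeff_summand i N k =
     2 ^ (\<Sum>j\<in>{1..<i}. k j)
     * (\<Prod>j\<in>{2..i}.
          falling_fact
            (of_nat N - of_nat (\<Sum>l\<in>{j..<i}. k l) - (2 * of_nat i + 2 - of_nat j) / 2)
            (k (j - 1)))
     * of_nat (odd_dfact (N - i - (\<Sum>j\<in>{1..<i}. k j)))"

text \<open>For \<open>i = 1\<close> the only index tuple is undefined everywhere, the product over
  \<open>{2..i}\<close> is empty and only \<open>odd_dfact (N - 1)\<close> remains. The case
  distinction in \<open>cheb_coeff\<close> thus disappears.\<close>

lemma cheb_coeff_eq_sum: "cheb_coeff i N = (\<Sum>k\<in>coeff_indices i N. coeff_summand i N k)"
proof (cases "i = 1")
  case True
  then have "coeff_indices i N = {\<lambda>_. undefined}"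
    by (simp add: coeff_indices_def)
  with True show ?thesis by (simp add: cheb_coeff_def coeff_summand_def)
qed (simp add: cheb_coeff_def coeff_summand_def)

text \<open>The factor at \<open>j = Suc i\<close> depends on \<open>c\<close> alone. In every other
  factor the increase of \<open>N\<close> by 1 cancels the increase of
  \<open>(2 i + 2 - j) / 2\<close> by 1, and the entry \<open>c\<close> of the partial sum turns
  \<open>N\<close> into \<open>N - c\<close>.\<close>

lemma coeff_summand_Suc_Suc:
  assumes "1 \<le> i" "c \<le> N"
  shows "(coeff_summand (Suc i) (Suc N) (k(i := c)) :: 'a::field_char_0) =
    2 ^ c * falling_fact (of_nat N - (of_nat i + 1) / 2) c * coeff_summand i (N - c) k"
proof -
  let ?k = "k(i := c)"
  have sum_k: "(\<Sum>l\<in>{j..<Suc i}. ?k l) = (\<Sum>l\<in>{j..<i}. k l) + c" if "j \<le> i" for j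
    using that by simp
  define g :: "nat \<Rightarrow> 'a" where "g j = falling_fact
      (of_nat (Suc N) - of_nat (\<Sum>l\<in>{j..<Suc i}. ?k l) - (2 * of_nat (Suc i) + 2 - of_nat j) / 2)
      (?k (j - 1))" for j
  have "(\<Prod>j\<in>{2..Suc i}. g j) = (\<Prod>j\<in>{2..i}. g j) * g (Suc i)"
    using assms by (simp add: prod.atLeast_Suc_atMost_Suc_shift numeral_2_eq_2 mult.commute)
  moreover have "g (Suc i) = falling_fact (of_nat N - (of_nat i + 1) / 2) c"
    by (simp add: g_def field_simps)
  moreover have "g j = falling_fact
      (of_nat (N - c) - of_nat (\<Sum>l\<in>{j..<i}. k l) - (2 * of_nat i + 2 - of_nat j) / 2)
      (k (j - 1))" if "j \<in> {2..i}" for j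
  proof -
    have "?k (j - 1) = k (j - 1)" using that by auto
    moreover have "j \<le> i" using that by simp
    ultimately show ?thesis
      using assms unfolding g_def sum_k[OF \<open>j \<le> i\<close>] by (simp add: of_nat_diff field_simps)
  qed
  moreover have "Suc N - Suc i - (\<Sum>j\<in>{1..<Suc i}. ?k j) = N - c - i - (\<Sum>j\<in>{1..<i}. k j)"
    unfolding sum_k[OF assms(1)] by simp
  ultimately show ?thesis
    unfolding coeff_summand_def g_def[symmetric] sum_k[OF assms(1)]
    by (simp add: power_add)
qed

text \<open>For \<open>j < i\<close> the entry \<open>k i\<close> occurs in the partial sum; moved
  to the right it leaves the bound \<open>(N - k i) - i\<close>. Resetting position \<open>i\<close>
  to \<open>undefined\<close> makes the tuple extensional on the smaller domain.\<close>

lemma coeff_indices_Suc_Suc: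
  assumes "1 \<le> i" "i \<le> N"
  shows "k \<in> coeff_indices (Suc i) (Suc N) \<longleftrightarrow>
    k i \<le> N - i \<and> k(i := undefined) \<in> coeff_indices i (N - k i)"
proof -
  have sum_k: "(\<Sum>l\<in>{j<..<Suc i}. k l) = (\<Sum>l\<in>{j<..<i}. k l) + k i" if "j < i" for j
  proof -
    have "{j<..<Suc i} = insert i {j<..<i}" using that by auto
    then show ?thesis by simp
  qed
  have sum_upd: "(\<Sum>l\<in>{j<..<i}. (k(i := undefined)) l) = (\<Sum>l\<in>{j<..<i}. k l)" for j
    by (intro sum.cong) auto
  show ?thesis
  proof (intro iffI conjI)
    assume k: "k \<in> coeff_indices (Suc i) (Suc N)"
    then have b: "\<And>j. j \<in> {1..<Suc i} \<Longrightarrow> k j + (\<Sum>l\<in>{j<..<Suc i}. k l) \<le> N - i"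
      by (auto simp: coeff_indices_def)
    from b[of i] assms show "k i \<le> N - i" by simp
    have c: "k j + (\<Sum>l\<in>{j<..<i}. k l) \<le> N - k i - i" if "j \<in> {1..<i}" for j
      using b[of j] that sum_k[of j] by simp
    have "k(i := undefined) \<in> {1..<i} \<rightarrow>\<^sub>E {0..N - k i - i}"
    proof (rule PiE_I)
      fix j assume "j \<in> {1..<i}"
      then show "(k(i := undefined)) j \<in> {0..N - k i - i}" using c[of j] by simp
    next
      fix j assume "j \<notin> {1..<i}"
      moreover have "k j = undefined" if "j \<notin> {1..<Suc i}"
        using k that by (auto simp: coeff_indices_def)
      ultimately show "(k(i := undefined)) j = undefined"
        using assms by (cases "j = i") auto
    qed
    moreover have "\<forall>j\<in>{1..<i}. (k(i := undefined)) j
        + (\<Sum>l\<in>{j<..<i}. (k(i := undefined)) l) \<le> N - k i - i"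
      unfolding sum_upd using c by simp
    ultimately show "k(i := undefined) \<in> coeff_indices i (N - k i)"
      unfolding coeff_indices_def by blast
  next
    assume "k i \<le> N - i \<and> k(i := undefined) \<in> coeff_indices i (N - k i)"
    then have ki: "k i \<le> N - i" and k: "k(i := undefined) \<in> coeff_indices i (N - k i)"
      by auto
    have c: "k j + (\<Sum>l\<in>{j<..<i}. k l) \<le> N - k i - i" if "j \<in> {1..<i}" for j
    proof -
      have "(k(i := undefined)) j + (\<Sum>l\<in>{j<..<i}. (k(i := undefined)) l) \<le> N - k i - i"
        using k that unfolding coeff_indices_def by blast
      then show ?thesis unfolding sum_upd using that by simp
    qed
    have b: "k j + (\<Sum>l\<in>{j<..<Suc i}. k l) \<le> N - i" if "j \<in> {1..<Suc i}" for j
    proof (cases "j = i")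
      case False
      then show ?thesis using c[of j] that sum_k[of j] ki by simp
    next
      case True
      moreover have "{i<..<Suc i} = {}" by auto
      ultimately show ?thesis using ki by simp
    qed
    have "k \<in> {1..<Suc i} \<rightarrow>\<^sub>E {0..N - i}"
    proof (rule PiE_I)
      fix j assume "j \<in> {1..<Suc i}"
      then show "k j \<in> {0..N - i}" using b[of j] by simp
    next
      fix j assume j: "j \<notin> {1..<Suc i}"
      have "k(i := undefined) \<in> {1..<i} \<rightarrow>\<^sub>E {0..N - k i - i}"
        using k unfolding coeff_indices_def by blast
      moreover have "j \<notin> {1..<i}" using j by auto
      ultimately have "(k(i := undefined)) j = undefined" by (rule PiE_arb)
      with j assms show "k j = undefined" by (auto split: if_splits)
    qed
    with b show "k \<in> coeff_indices (Suc i) (Suc N)"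
      unfolding coeff_indices_def by simp
  qed
qed

text \<open>Peels off the outermost summation variable \<open>k\<^sub>i\<close> (here \<open>c\<close>).\<close>

lemma cheb_coeff_Suc_Suc_eq_sum:
  assumes "1 \<le> i" "i \<le> N"
  shows "(cheb_coeff (Suc i) (Suc N) :: 'a::field_char_0) =
    (\<Sum>c=0..N - i. 2 ^ c * falling_fact (of_nat N - (of_nat i + 1) / 2) c * cheb_coeff i (N - c))"
proof -
  let ?S = "SIGMA c:{0..N - i}. coeff_indices i (N - c)"
  have undef: "k i = undefined" if "k \<in> coeff_indices i M" for k M
    using that unfolding coeff_indices_def by auto
  have "(\<Sum>c=0..N - i. 2 ^ c * falling_fact (of_nat N - (of_nat i + 1) / 2) c
        * (cheb_coeff i (N - c) :: 'a))
      = (\<Sum>(c, k)\<in>?S. 2 ^ c * falling_fact (of_nat N - (of_nat i + 1) / 2) c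
        * coeff_summand i (N - c) k)"
    by (simp add: cheb_coeff_eq_sum sum_distrib_left sum.Sigma finite_coeff_indices)
  also have "\<dots> = (\<Sum>k\<in>coeff_indices (Suc i) (Suc N). coeff_summand (Suc i) (Suc N) k)"
  \<comment> \<open>Tuples of the shorter kind are \<open>undefined\<close> at \<open>i\<close>, so
    setting that entry to \<open>c\<close> and resetting it are mutually inverse.\<close>
  proof (rule sum.reindex_bij_witness[of _ "\<lambda>k. (k i, k(i := undefined))" "\<lambda>(c, k). k(i := c)"])
    fix a assume a: "a \<in> ?S"
    obtain c k where [simp]: "a = (c, k)" by fastforce
    from a have c: "c \<le> N - i" and k: "k \<in> coeff_indices i (N - c)" by auto
    from undef[OF k] have upd: "k(i := undefined) = k" by auto
    show "((case a of (c, k) \<Rightarrow> k(i := c)) i, (case a of (c, k) \<Rightarrow> k(i := c))(i := undefined)) = a"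
      using upd by simp
    show "(case a of (c, k) \<Rightarrow> k(i := c)) \<in> coeff_indices (Suc i) (Suc N)"
      using upd c k by (simp add: coeff_indices_Suc_Suc[OF assms])
    show "(coeff_summand (Suc i) (Suc N) (case a of (c, k) \<Rightarrow> k(i := c)) :: 'a) =
      (case a of (c, k) \<Rightarrow> 2 ^ c * falling_fact (of_nat N - (of_nat i + 1) / 2) c
        * coeff_summand i (N - c) k)"
      using c assms by (simp add: coeff_summand_Suc_Suc del: fun_upd_apply)
  qed (use assms in \<open>auto simp: coeff_indices_Suc_Suc\<close>)
  finally show ?thesis by (simp add: cheb_coeff_eq_sum)
qed

text \<open>Only \<open>c = 0\<close> survives in the sum. This supplies the top coefficient, which
  \<open>cheb_coeff_rec\<close> does not reach.\<close>

lemma cheb_coeff_diag: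
  assumes "1 \<le> i"
  shows "(cheb_coeff (Suc i) (Suc i) :: 'a::field_char_0) = cheb_coeff i i"
  using assms by (simp add: cheb_coeff_Suc_Suc_eq_sum falling_fact_def)

text \<open>In the sum over \<open>c\<close>, the term \<open>c = 0\<close> is
  \<open>cheb_coeff i (Suc N)\<close>. In the others \<open>(y + 1)_(c + 1) = (y + 1) (y)_c\<close>
  with \<open>y = N - (i + 1) / 2\<close>, so \<open>2 (y + 1) = 2 (N + 1) - (i + 1)\<close> comes
  out in front of the sum for \<open>Suc N\<close>.\<close>

lemma cheb_coeff_rec:
  assumes "1 \<le> i" "i \<le> N"
  shows "(cheb_coeff (Suc i) (Suc (Suc N)) :: 'a::field_char_0) =
    of_nat (2 * Suc N - Suc i) * cheb_coeff (Suc i) (Suc N) + cheb_coeff i (Suc N)"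
proof -
  let ?y = "of_nat N - (of_nat i + 1) / 2 :: 'a"
  have y: "of_nat (Suc N) - (of_nat i + 1) / 2 = ?y + 1" by simp
  have y': "2 * (?y + 1) = of_nat (2 * Suc N - Suc i)"
    using assms by (simp add: of_nat_diff field_simps)
  have "(cheb_coeff (Suc i) (Suc (Suc N)) :: 'a) =
      (\<Sum>c=0..Suc (N - i). 2 ^ c * falling_fact (?y + 1) c * cheb_coeff i (Suc N - c))"
    using assms by (simp add: cheb_coeff_Suc_Suc_eq_sum Suc_diff_le y del: of_nat_Suc)
  also have "\<dots> = cheb_coeff i (Suc N)
      + (\<Sum>c=0..N - i. 2 ^ Suc c * falling_fact (?y + 1) (Suc c) * cheb_coeff i (N - c))"
    by (subst sum.atLeast0_atMost_Suc_shift) (simp add: falling_fact_def)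
  also have "(\<Sum>c=0..N - i. 2 ^ Suc c * falling_fact (?y + 1) (Suc c) * cheb_coeff i (N - c))
      = 2 * (?y + 1) * cheb_coeff (Suc i) (Suc N)"
    unfolding falling_fact_Suc_shift cheb_coeff_Suc_Suc_eq_sum[OF assms] sum_distrib_left
    by (intro sum.cong refl) (simp only: power_Suc mult_ac)
  finally show ?thesis unfolding y' by simp
qed

lemma cheb_coeff_1_rec:
  assumes "1 \<le> N"
  shows "(cheb_coeff 1 (Suc N) :: 'a::field_char_0) = of_nat (2 * N - 1) * cheb_coeff 1 N"
  using assms by (cases N) (simp_all add: cheb_coeff_def odd_dfact_def algebra_simps)

section \<open>The differential equation\<close>

text \<open>Here \<open>d\<close> stands for \<open>x - t\<close> and \<open>D\<close> for its
  inverse. Multiplication by \<open>D\<close> cancels the \<open>d\<close> in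
  \<open>F' = 2 d F^2\<close>, so \<open>D (F^(N+1))' = 2 (N + 1) F^(N+2)\<close>; applying this
  operation to both sides is the induction step.\<close>

lemma fps_power_eq_sum_nth_deriv:
  fixes F d D :: "'a::field_char_0 fps"
  assumes F: "fps_deriv F = 2 * d * F ^ 2" and D: "fps_deriv D = D ^ 2" and dD: "d * D = 1"
    and "1 \<le> N"
  shows "of_nat (2 ^ N * fact N) * F ^ Suc N =
    (\<Sum>i=1..N. fps_const (cheb_coeff i N) * D ^ (2 * N - i) * fps_nth_deriv i F)"
  using \<open>1 \<le> N\<close>
proof (induction N rule: dec_induct)
  case base
  have "D * (2 * d * F ^ 2) = 2 * (d * D) * F ^ 2" by (simp only: mult_ac)
  then show ?case
    by (simp add: cheb_coeff_def odd_dfact_def F dD power2_eq_square)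
next
  case (step N)
  let ?a = "\<lambda>i N. fps_const (cheb_coeff i N) :: 'a fps"
  let ?T = "\<lambda>i. D ^ (2 * Suc N - i) * fps_nth_deriv i F"
  have dpow: "fps_deriv (D ^ k) = of_nat k * D ^ Suc k" for k
    unfolding fps_deriv_power D fps_of_nat
    by (cases k) (simp_all add: power2_eq_square algebra_simps)
  have "of_nat (2 ^ Suc N * fact (Suc N)) * F ^ Suc (Suc N) =
      of_nat (2 ^ Suc N * fact (Suc N)) * F ^ Suc (Suc N) * (d * D)"
    by (simp add: dD)
  also have "\<dots> = D * fps_deriv (of_nat (2 ^ N * fact N) * F ^ Suc N)"
  proof -
    have "fps_deriv (of_nat (2 ^ N * fact N) * F ^ Suc N) =
        of_nat (2 ^ N * fact N) * (of_nat (Suc N) * (2 * d * F ^ 2) * F ^ N)"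
      by (simp add: fps_deriv_power F del: power_Suc flip: fps_of_nat)
    then show ?thesis by (simp add: power2_eq_square algebra_simps)
  qed
  also have "\<dots> = (\<Sum>i=1..N. ?a i N *
      (D * (of_nat (2 * N - i) * D ^ Suc (2 * N - i) * fps_nth_deriv i F
        + D ^ (2 * N - i) * fps_nth_deriv (Suc i) F)))"
    unfolding step.IH fps_deriv_sum sum_distrib_left
    by (intro sum.cong refl)
       (simp add: dpow fps_nth_deriv_commute[symmetric] algebra_simps
         del: fps_nth_deriv.simps(2))
  also have "\<dots> = (\<Sum>i=1..N. of_nat (2 * N - i) * ?a i N * ?T i + ?a i N * ?T (Suc i))"
  proof (intro sum.cong refl)
    fix i assume "i \<in> {1..N}"
    then have "2 * Suc N - i = Suc (Suc (2 * N - i))" "2 * Suc N - Suc i = Suc (2 * N - i)"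
      by auto
    then show "?a i N * (D * (of_nat (2 * N - i) * D ^ Suc (2 * N - i) * fps_nth_deriv i F
        + D ^ (2 * N - i) * fps_nth_deriv (Suc i) F)) =
        of_nat (2 * N - i) * ?a i N * ?T i + ?a i N * ?T (Suc i)"
      by (simp add: algebra_simps del: fps_nth_deriv.simps(2))
  qed
  also have "\<dots> = (\<Sum>i=1..N. of_nat (2 * N - i) * ?a i N * ?T i) + (\<Sum>i=1..N. ?a i N * ?T (Suc i))"
    by (rule sum.distrib)
  \<comment> \<open>The coefficients of each \<open>?T\<close> are compared: that of
    \<open>?T 1\<close> by \<open>cheb_coeff_1_rec\<close>, that of \<open>?T (Suc N)\<close> by
    \<open>cheb_coeff_diag\<close>, and the \<open>M = N - 1\<close> inner ones by
    \<open>cheb_coeff_rec\<close>.\<close>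
  also have "\<dots> = (\<Sum>i=1..Suc N. ?a i (Suc N) * ?T i)"
  proof -
    obtain M where M: "N = Suc M" using step.hyps by (cases N) auto
    have "(\<Sum>i=1..N. of_nat (2 * N - i) * ?a i N * ?T i) =
        of_nat (2 * N - 1) * ?a 1 N * ?T 1
        + (\<Sum>i=1..M. of_nat (2 * N - Suc i) * ?a (Suc i) N * ?T (Suc i))"
      unfolding M by (subst sum.atLeast_Suc_atMost)
        (simp_all only: One_nat_def sum.shift_bounds_cl_Suc_ivl Suc_le_mono le0)
    moreover have "(\<Sum>i=1..N. ?a i N * ?T (Suc i)) =
        (\<Sum>i=1..M. ?a i N * ?T (Suc i)) + ?a N N * ?T (Suc N)"
      unfolding M by (simp del: fps_nth_deriv.simps(2))
    moreover have "(\<Sum>i=1..Suc N. ?a i (Suc N) * ?T i) =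
        ?a 1 (Suc N) * ?T 1 + (\<Sum>i=1..M. ?a (Suc i) (Suc N) * ?T (Suc i))
        + ?a (Suc N) (Suc N) * ?T (Suc N)"
    proof -
      have "(\<Sum>i=1..Suc N. ?a i (Suc N) * ?T i) =
        ?a 1 (Suc N) * ?T 1 + (\<Sum>i=1..N. ?a (Suc i) (Suc N) * ?T (Suc i))"
        by (subst sum.atLeast_Suc_atMost)
          (simp_all only: One_nat_def sum.shift_bounds_cl_Suc_ivl Suc_le_mono le0)
      then show ?thesis unfolding M by (simp add: add.assoc del: fps_nth_deriv.simps(2))
    qed
    moreover have "?a (Suc N) (Suc N) = ?a N N"
      using step.hyps by (simp add: cheb_coeff_diag)
    moreover have "?a 1 (Suc N) = of_nat (2 * N - 1) * ?a 1 N"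
      using cheb_coeff_1_rec[OF step.hyps(1), where 'a = 'a] by (simp add: fps_of_nat[symmetric])
    moreover have "?a (Suc i) (Suc N) * ?T (Suc i) =
        of_nat (2 * N - Suc i) * ?a (Suc i) N * ?T (Suc i) + ?a i N * ?T (Suc i)"
      if "i \<in> {1..M}" for i
    proof -
      have "?a (Suc i) (Suc N) = of_nat (2 * N - Suc i) * ?a (Suc i) N + ?a i N"
        using that unfolding M
        by (subst cheb_coeff_rec) (simp_all only: fps_of_nat[symmetric]
            fps_const_mult[symmetric] fps_const_add[symmetric] atLeastAtMost_iff)
      then show ?thesis by (simp only: distrib_right)
    qed
    ultimately show ?thesis
      by (simp add: sum.distrib del: fps_nth_deriv.simps(2))
  qed
  finally show ?case by (simp only: mult.assoc)
qed

section \<open>Comparison of coefficients\<close>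

text \<open>Both sides equal the \<open>n\<close>-th coefficient of \<open>F^(N+1)\<close>. The
  argument works at any nonzero \<open>x\<close> of the field, since then \<open>x - t\<close> is an
  invertible power series.\<close>

lemma cheb4_order_identity:
  fixes x :: "'a::field_char_0"
  assumes "x \<noteq> 0" "N \<ge> 1"
  shows "(\<Sum>l=0..n. (-1) ^ (n - l) * of_nat ((N + n - l) choose (n - l)) * cheb4_order (N + 1) l x)
    = 1 / (2 ^ N * of_nat (fact N)) *
      (\<Sum>i=1..N. \<Sum>l=0..i.
         (-1) ^ (i - l) * cheb_coeff i N * (of_nat (fact i) / of_nat (fact l)) *
         (\<Sum>(m, s, p)\<in>{(m, s, p). m + s + p = n}.
            (-1) ^ s * of_nat ((2 * N + m - i - 1) choose m) * of_nat ((i - l + s) choose s)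
            * falling_fact (of_nat (p + l)) l
            * x powi (int i - 2 * int N - int m) * cheb4 (p + l) x))"
    (is "?lhs = 1 / ?c * (\<Sum>i=1..N. \<Sum>l=0..i. ?b i l * ?S i l)")
proof -
  define q :: "'a fps" where "q = 1 - fps_const (2 * x) * fps_X + fps_X ^ 2"
  define F where "F = inverse q"
  define d where "d = fps_const x - fps_X"
  define D where "D = inverse d"
  define G :: "'a fps" where "G = inverse (1 + fps_X)"
  define W where "W = cheb4_gf x"
  have q0: "fps_nth q 0 = 1" by (simp add: q_def)
  have W: "W = (1 + fps_X) * F"
    unfolding W_def cheb4_gf_def F_def q_def[symmetric]
    using q0 by (simp add: fps_divide_unit)
  have "(1 + fps_X) * G = 1"
    unfolding G_def by (rule inverse_mult_eq_1') simp
  then have F_eq: "F = W * G"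
    unfolding W by (metis mult.assoc mult.commute mult_1)
  have "fps_deriv q = - 2 * d"
    unfolding q_def d_def
    by (simp add: fps_deriv_power algebra_simps numeral_fps_const power2_eq_square)
  then have dF: "fps_deriv F = 2 * d * F ^ 2"
    unfolding F_def using q0 by (simp add: fps_inverse_deriv power2_eq_square)
  have d0: "fps_nth d 0 \<noteq> 0" using assms by (simp add: d_def)
  have "fps_deriv d = -1" by (simp add: d_def)
  then have dD: "fps_deriv D = D ^ 2"
    unfolding D_def using d0 by (simp add: fps_inverse_deriv power2_eq_square)
  have dd: "d * D = 1" unfolding D_def using d0 by (rule inverse_mult_eq_1')

  have "?lhs = fps_nth (W ^ Suc N * G ^ Suc N) n"
    unfolding fps_mult_nth
  proof (intro sum.cong refl)
    fix l assume "l \<in> {0..n}"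
    then have "N + n - l = N + (n - l)" by simp
    then show "(-1) ^ (n - l) * of_nat ((N + n - l) choose (n - l)) * cheb4_order (N + 1) l x =
        fps_nth (W ^ Suc N) l * fps_nth (G ^ Suc N) (n - l)"
      unfolding G_def W_def
      by (simp only: cheb4_order_def one_plus_X_neg_power_nth Suc_eq_plus1[symmetric] mult_ac)
  qed
  also have "\<dots> = fps_nth (F ^ Suc N) n"
    by (simp only: F_eq power_mult_distrib)
  finally have lhs: "?lhs = fps_nth (F ^ Suc N) n" .

  \<comment> \<open>The indices \<open>m\<close>, \<open>s\<close>, \<open>p\<close> belong to the
    powers of \<open>1 / (x - t)\<close>, the powers of \<open>1 / (1 + t)\<close> and the
    derivative of \<open>W\<close>, respectively.\<close>
  have S: "fps_nth (D ^ (2 * N - i) * G ^ Suc (i - l) * fps_nth_deriv l W) n = ?S i l"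
    if "i \<in> {1..N}" for i l
    unfolding fps_mult_nth_triple
  proof (intro sum.cong refl, clarify)
    fix m s p
    have "x powi (int i - 2 * int N - int m) = inverse x ^ (2 * N - i + m)"
    proof -
      have "int i - 2 * int N - int m = - int (2 * N - i + m)" using that by auto
      then show ?thesis by (simp only: power_int_minus power_int_of_nat power_inverse)
    qed
    \<comment> \<open>From \<open>1 \<le> i \<le> N\<close> the exponent \<open>2 * N - i\<close> is
      positive, as the negative binomial series requires, and the truncated subtractions
      agree.\<close>
    moreover have "2 * N - i + m - 1 = 2 * N + m - i - 1" "2 * N - i > 0" using that by auto
    ultimately have "fps_nth (D ^ (2 * N - i)) m =
        of_nat ((2 * N + m - i - 1) choose m) * x powi (int i - 2 * int N - int m)"
      using assms by (simp add: D_def d_def const_minus_X_neg_power_nth)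
    then show "fps_nth (D ^ (2 * N - i)) m * fps_nth (G ^ Suc (i - l)) s
        * fps_nth (fps_nth_deriv l W) p =
      (-1) ^ s * of_nat ((2 * N + m - i - 1) choose m) * of_nat ((i - l + s) choose s)
        * falling_fact (of_nat (p + l)) l
        * x powi (int i - 2 * int N - int m) * cheb4 (p + l) x"
      unfolding G_def W_def
      by (simp only: one_plus_X_neg_power_nth fps_nth_deriv_nth
          cheb4_def mult_ac)
  qed

  \<comment> \<open>Leibniz' rule for \<open>W * G\<close>: the factor \<open>(i - l)!\<close> from
    the derivative of \<open>G\<close> cancels in the binomial coefficient and leaves
    \<open>i! / l!\<close>, while the sign also comes from \<open>G\<close>.\<close>
  have deriv_F: "fps_nth_deriv i F = (\<Sum>l=0..i.
      fps_const ((-1) ^ (i - l) * (of_nat (fact i) / of_nat (fact l)))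
        * (G ^ Suc (i - l) * fps_nth_deriv l W))" for i
    unfolding F_eq fps_nth_deriv_mult
  proof (intro sum.cong refl)
    fix l assume "l \<in> {0..i}"
    then have "(of_nat (i choose l) * of_nat (fact (i - l)) :: 'a) = of_nat (fact i) / of_nat (fact l)"
      by (simp add: binomial_fact)
    moreover have "fps_const ((-1) ^ (i - l) :: 'a) = (-1) ^ (i - l)"
      by (cases "even (i - l)") simp_all
    ultimately have "fps_const ((-1) ^ (i - l) * (of_nat (fact i) / of_nat (fact l)) :: 'a) =
        (-1) ^ (i - l) * (of_nat (i choose l) * of_nat (fact (i - l)))"
      by (metis fps_const_mult fps_of_nat)
    then show "of_nat (i choose l) * fps_nth_deriv l W * fps_nth_deriv (i - l) G =
        fps_const ((-1) ^ (i - l) * (of_nat (fact i) / of_nat (fact l)))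
          * (G ^ Suc (i - l) * fps_nth_deriv l W)"
      unfolding G_def by (simp only: fps_nth_deriv_inverse_one_plus_X mult_ac)
  qed

  have "?c * ?lhs = fps_nth (of_nat (2 ^ N * fact N) * F ^ Suc N) n"
    unfolding lhs by (simp flip: fps_of_nat del: power_Suc)
  also have "\<dots> = (\<Sum>i=1..N. \<Sum>l=0..i. fps_nth (fps_const (?b i l)
      * (D ^ (2 * N - i) * G ^ Suc (i - l) * fps_nth_deriv l W)) n)"
    unfolding fps_power_eq_sum_nth_deriv[OF dF dD dd \<open>N \<ge> 1\<close>] deriv_F fps_sum_nth sum_distrib_left
    by (intro sum.cong refl arg_cong2[where f = fps_nth])
       (simp only: fps_const_mult[symmetric] mult_ac)
  also have "\<dots> = (\<Sum>i=1..N. \<Sum>l=0..i. ?b i l * ?S i l)"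
    by (intro sum.cong refl) (simp only: S fps_mult_left_const_nth)
  finally have "?c * ?lhs = (\<Sum>i=1..N. \<Sum>l=0..i. ?b i l * ?S i l)" .
  moreover have "?c \<noteq> 0" by simp
  moreover have "b = 1 / c * a" if "c * b = a" "c \<noteq> 0" for a b c :: 'a
    using that by auto
  ultimately show ?thesis by blast
qed

theorem theorem6:
  fixes N n :: nat
  assumes "N \<ge> 1"
  shows "(\<Sum>l=0..n. (-1) ^ (n - l) * of_nat ((N + n - l) choose (n - l)) * cheb4_order (N + 1) l (ratfun_X :: 'a::field_char_0 poly fract))
    = 1 / (2 ^ N * of_nat (fact N)) *
      (\<Sum>i=1..N. \<Sum>l=0..i.
         (-1) ^ (i - l) * cheb_coeff i N * (of_nat (fact i) / of_nat (fact l)) *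
         (\<Sum>(m, s, p)\<in>{(m, s, p). m + s + p = n}.
            (-1) ^ s * of_nat ((2 * N + m - i - 1) choose m) * of_nat ((i - l + s) choose s)
            * falling_fact (of_nat (p + l)) l
            * ratfun_X powi (int i - 2 * int N - int m) * cheb4 (p + l) ratfun_X))"
  \<comment> \<open>The indeterminate is a nonzero element of the field of rational functions, which
    has characteristic 0.\<close>
  using assms by (intro cheb4_order_identity) (simp_all add: ratfun_X_def)

end
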